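(* Let $\mathbb{K}$ be an algebraically closed field of characteristic zero, let $p\in\mathbb{K}[\mathbf{x},y]$ be non-zero, and let $\mathrm{lc}_y(p)\in\mathbb{K}[\mathbf{x}]$ denote the leading coefficient of $p$ with respect to $y$. A series $\varphi$ in $\mathbf{x}$ over $\mathbb{K}$ is a rational solution of $p(\mathbf{x},y)=0$ if and only if $\mathrm{lc}_y(p)\,\varphi$ is a polynomial solution of $p(\mathbf{x},y/\mathrm{lc}_y(p))=0$.
   Context: $\mathbf{x}=(x_1,\dots,x_n)$. A series in $\mathbf{x}$ over $\mathbb{K}$ is a formal sum $\varphi=\sum_{I\in\mathbb{Q}^n}a_I\mathbf{x}^I$, $a_I\in\mathbb{K}$, whose support $\{I:a_I\neq0\}$ is contained in $(v+C)\cap\frac1k\mathbb{Z}^n$ for some $v\in\mathbb{R}^n$, some strictly convex (convex, containing no line) rational (generated by finitely many integer vectors) cone $C\subseteq\mathbb{R}^n$ and some non-zero integer $k$. A solution $\varphi$ is rational if there are $r,q\in\mathbb{K}[\mathbf{x}]$, $q\neq0$, with $q\varphi=r$, and polynomial if it is an element of $\mathbb{K}[\mathbf{x}]$. *)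

theory Defs
  imports
    "HOL-Analysis.Convex_Euclidean_Space"
    "HOL-Analysis.Cartesian_Euclidean_Space"
    "HOL-Library.Poly_Mapping"
    "HOL-Computational_Algebra.Polynomial_Factorial"
begin

text \<open>
  The variables are indexed by a finite type \<open>'n\<close>. Its linear order plays no mathematical role:
  the library needs it to make \<open>('n, 'a) mpoly\<close> an integral domain, so that fractions can be
  formed. The ring of polynomials in the variables and in \<open>y\<close> is \<open>('n, 'a) mpoly poly\<close>,
  in which \<^const>\<open>lead_coeff\<close> is the leading coefficient with respect to \<open>y\<close>.
\<close>

type_synonym ('n, 'a) mpoly = "('n \<Rightarrow>\<^sub>0 nat) \<Rightarrow>\<^sub>0 'a"

type_synonym ('n, 'a) formal_sum = "rat ^ 'n \<Rightarrow> 'a"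

definition strictly_convex_rational_cone :: "(real ^ 'n::finite) set \<Rightarrow> bool" where
  "strictly_convex_rational_cone C \<longleftrightarrow>
     (\<exists>G. finite G \<and> (\<forall>g\<in>G. \<forall>i. g $ i \<in> \<int>) \<and> C = convex_cone hull G) \<and>
     \<not> (\<exists>a d. d \<noteq> 0 \<and> (\<forall>t::real. a + t *\<^sub>R d \<in> C))"

definition supp :: "('n::finite, 'a::zero) formal_sum \<Rightarrow> (rat ^ 'n) set" where
  "supp \<phi> = {I. \<phi> I \<noteq> 0}"

definition is_series :: "('n::finite, 'a::zero) formal_sum \<Rightarrow> bool" where
  "is_series \<phi> \<longleftrightarrow>
     (\<exists>(v :: real ^ 'n) C (k :: int). strictly_convex_rational_cone C \<and> k \<noteq> 0 \<and>
        (\<forall>I \<in> supp \<phi>. (\<chi> i. of_rat (I $ i)) \<in> (\<lambda>c. v + c) ` C \<and>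
                       (\<forall>i. of_int k * I $ i \<in> \<int>)))"

text \<open>
  The Cauchy product. The index set of the sum is finite whenever one factor has finite support, and
  whenever both supports lie in translates of one strictly convex rational cone and in one lattice
  \<open>1/k \<int>\<^sup>n\<close>. These are the only cases used: polynomial times series, and powers of one series.
\<close>

definition fs_mult ::
  "('n::finite, 'a::semiring_0) formal_sum \<Rightarrow> ('n, 'a) formal_sum \<Rightarrow> ('n, 'a) formal_sum"
  where "fs_mult \<phi> \<psi> = (\<lambda>K. \<Sum>I | I \<in> supp \<phi> \<and> K - I \<in> supp \<psi>. \<phi> I * \<psi> (K - I))"

definition fs_of_mpoly :: "('n::finite, 'a::comm_monoid_add) mpoly \<Rightarrow> ('n, 'a) formal_sum" where
  "fs_of_mpoly r =
     (\<lambda>I. \<Sum>m\<in>Poly_Mapping.keys r. Poly_Mapping.lookup r m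
        when (\<chi> i. of_nat (Poly_Mapping.lookup m i)) = I)"

primrec fs_power ::
  "('n::finite, 'a::semiring_1) formal_sum \<Rightarrow> nat \<Rightarrow> ('n, 'a) formal_sum"
  where
    "fs_power \<phi> 0 = fs_of_mpoly 1"
  | "fs_power \<phi> (Suc j) = fs_mult \<phi> (fs_power \<phi> j)"

definition fs_eval ::
  "('n::finite, 'a::comm_semiring_1) mpoly poly \<Rightarrow> ('n, 'a) formal_sum \<Rightarrow> ('n, 'a) formal_sum"
  where "fs_eval p \<phi> =
    (\<lambda>K. \<Sum>j\<le>degree p. fs_mult (fs_of_mpoly (coeff p j)) (fs_power \<phi> j) K)"

definition is_rational ::
  "('n::finite, 'a::comm_semiring_1) formal_sum \<Rightarrow> bool"
  where "is_rational \<phi> \<longleftrightarrow>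
    (\<exists>r q. q \<noteq> 0 \<and> fs_mult (fs_of_mpoly q) \<phi> = fs_of_mpoly r)"

definition rational_solution ::
  "('n::finite, 'a::comm_semiring_1) mpoly poly \<Rightarrow> ('n, 'a) formal_sum \<Rightarrow> bool"
  where "rational_solution p \<phi> \<longleftrightarrow> is_rational \<phi> \<and> fs_eval p \<phi> = (\<lambda>_. 0)"

text \<open>
  Polynomial solutions of an equation \<open>P(y) = 0\<close> with coefficients in the field of rational
  functions, such as \<open>p(x, y / lc(p)) = 0\<close>: the polynomial is substituted for \<open>y\<close> in that field.
\<close>

definition polynomial_solution ::
  "('n::{finite,linorder}, 'a::field) mpoly fract poly \<Rightarrow> ('n, 'a) formal_sum \<Rightarrow> bool"
  where "polynomial_solution P \<psi> \<longleftrightarrow>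
    (\<exists>s. \<psi> = fs_of_mpoly s \<and> poly P (to_fract s) = 0)"

definition subst_y_div_lc ::
  "('n::{finite,linorder}, 'a::field) mpoly poly \<Rightarrow> ('n, 'a) mpoly fract poly"
  where "subst_y_div_lc p = pcompose (fract_poly p) [:0, 1 / to_fract (lead_coeff p):]"

end

theory Submission
  imports Defs
begin

text \<open>
  Let \<open>L\<close> be the leading coefficient and \<open>d\<close> the degree of \<open>p\<close> in \<open>y\<close>. If
  \<open>q \<phi> = r\<close> with polynomials \<open>q\<close>, \<open>r\<close>, then \<open>q ^ d p(\<phi>)\<close> is the polynomial
  \<open>\<Sum>j\<le>d. p\<^sub>j r ^ j q ^ (d - j)\<close>. Series form a torsion-free module over the polynomials, since
  minimal exponents add up; so \<open>p(\<phi>) = 0\<close> exactly if this polynomial vanishes. For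
  \<open>q = L\<close> this is one direction. Conversely, if it vanishes then \<open>L r / q\<close> is integral over the
  polynomial ring, hence a polynomial, and it equals \<open>L \<phi>\<close> by torsion-freeness.
\<close>

section \<open>Supports and leading exponents of polynomials\<close>

text \<open>Setting a value at a key outside the support amounts to adding a monomial, so identities
  additive in a polynomial can be checked on monomials.\<close>

lemma poly_mapping_additive_induct [case_names zero single add]:
  fixes f :: "'k \<Rightarrow>\<^sub>0 'b::comm_monoid_add"
  assumes "P 0" and "\<And>k c. P (Poly_Mapping.single k c)"
    and "\<And>f g. P f \<Longrightarrow> P g \<Longrightarrow> P (f + g)"
  shows "P f"
proof (induction f rule: update_induct)
  case const
  show ?case by fact
next
  case (update f a b)
  have "Poly_Mapping.update a b f = f + Poly_Mapping.single a b"
    using update.hyps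
    by (intro poly_mapping_eqI)
       (auto simp: lookup_update lookup_add lookup_single when_def in_keys_iff)
  then show ?case using assms update.IH by metis
qed

lemma lookup_mult_keys:
  fixes f g :: "'k::monoid_add \<Rightarrow>\<^sub>0 'b::semiring_0"
  shows "Poly_Mapping.lookup (f * g) k =
    (\<Sum>l\<in>Poly_Mapping.keys f. \<Sum>m\<in>Poly_Mapping.keys g.
       Poly_Mapping.lookup f l * Poly_Mapping.lookup g m when k = l + m)"
proof -
  have inner: "(\<Sum>q. Poly_Mapping.lookup g q when k = l + q) =
      (\<Sum>m\<in>Poly_Mapping.keys g. Poly_Mapping.lookup g m when k = l + m)" for l
    by (rule Sum_any.expand_superset) (auto simp: in_keys_iff when_def)
  have "Poly_Mapping.lookup (f * g) k = (\<Sum>l\<in>Poly_Mapping.keys f. Poly_Mapping.lookup f l *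
      (\<Sum>m\<in>Poly_Mapping.keys g. Poly_Mapping.lookup g m when k = l + m))"
    unfolding lookup_mult inner
    by (rule Sum_any.expand_superset) (auto simp: in_keys_iff)
  then show ?thesis
    by (simp add: sum_distrib_left mult_when)
qed

text \<open>Addition is strictly monotone, so \<open>a + b\<close> arises from no other pair of
  exponents; its coefficient is a product of two non-zero coefficients.\<close>

lemma Max_keys_mult:
  fixes f g :: "'k::{ordered_cancel_comm_monoid_add, linorder} \<Rightarrow>\<^sub>0 'b::semiring_no_zero_divisors"
  assumes "f \<noteq> 0" "g \<noteq> 0"
  defines "a \<equiv> Max (Poly_Mapping.keys f)" and "b \<equiv> Max (Poly_Mapping.keys g)"
  shows lookup_mult_Max: "Poly_Mapping.lookup (f * g) (a + b) =
      Poly_Mapping.lookup f a * Poly_Mapping.lookup g b"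
    and "Max (Poly_Mapping.keys (f * g)) = a + b"
proof -
  have ne: "Poly_Mapping.keys f \<noteq> {}" "Poly_Mapping.keys g \<noteq> {}"
    using assms(1,2) by auto
  have a: "a \<in> Poly_Mapping.keys f" "\<And>l. l \<in> Poly_Mapping.keys f \<Longrightarrow> l \<le> a"
    and b: "b \<in> Poly_Mapping.keys g" "\<And>m. m \<in> Poly_Mapping.keys g \<Longrightarrow> m \<le> b"
    using ne by (simp_all add: a_def b_def)
  have eq: "a + b = l + m \<longleftrightarrow> l = a \<and> m = b"
    if "l \<in> Poly_Mapping.keys f" "m \<in> Poly_Mapping.keys g" for l m
    using a(2)[OF that(1)] b(2)[OF that(2)]
    by (metis add_less_le_mono add_le_less_mono order.strict_iff_order)
  have "Poly_Mapping.lookup (f * g) (a + b) = (\<Sum>l\<in>Poly_Mapping.keys f. \<Sum>m\<in>Poly_Mapping.keys g.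
       if m = b then (if l = a then Poly_Mapping.lookup f l * Poly_Mapping.lookup g m else 0) else 0)"
    unfolding lookup_mult_keys by (intro sum.cong refl) (auto simp: eq when_def)
  also have "\<dots> = Poly_Mapping.lookup f a * Poly_Mapping.lookup g b"
    using a(1) b(1) by (simp add: sum.delta)
  finally show *: "Poly_Mapping.lookup (f * g) (a + b) =
      Poly_Mapping.lookup f a * Poly_Mapping.lookup g b" .
  show "Max (Poly_Mapping.keys (f * g)) = a + b"
  proof (rule Max_eqI)
    show "a + b \<in> Poly_Mapping.keys (f * g)"
      using a(1) b(1) * by (simp add: in_keys_iff)
    show "k \<le> a + b" if "k \<in> Poly_Mapping.keys (f * g)" for k
      using that keys_mult[of f g] a(2) b(2) by (auto intro!: add_mono)
  qed simp
qed

text \<open>The constant sum encodes the \<open>n\<close>-fold multiple; for exponents of monomials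
  it becomes a product at each variable.\<close>

lemma Max_keys_power:
  fixes f :: "'k::{ordered_cancel_comm_monoid_add, linorder} \<Rightarrow>\<^sub>0 'b::idom"
  assumes "f \<noteq> 0"
  shows "Max (Poly_Mapping.keys (f ^ n)) = (\<Sum>_<n. Max (Poly_Mapping.keys f))"
proof (induction n)
  case (Suc n)
  then show ?case
    using assms Max_keys_mult(2)[of f "f ^ n"] by (simp add: add.commute)
qed simp

section \<open>Complete integral closedness of the polynomial ring\<close>

text \<open>With the finitely many variables listed increasingly, this order embeds into the
  lexicographic order on lists of equal length over the naturals.\<close>

lemma wf_less_poly_mapping:
  "wf {(f, g :: 'n::{finite,linorder} \<Rightarrow>\<^sub>0 nat). f < g}"
proof -
  define ns where "ns = sorted_list_of_set (UNIV :: 'n set)"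
  have "(map (Poly_Mapping.lookup f) ns, map (Poly_Mapping.lookup g) ns) \<in> lex less_than"
    if "f < g" for f g :: "'n \<Rightarrow>\<^sub>0 nat"
  proof -
    obtain k where k: "Poly_Mapping.lookup f k < Poly_Mapping.lookup g k"
      "\<And>l. l < k \<Longrightarrow> Poly_Mapping.lookup f l = Poly_Mapping.lookup g l"
      using \<open>f < g\<close> unfolding less_poly_mapping.rep_eq less_fun_def by auto
    have "k \<in> set ns" by (simp add: ns_def)
    then obtain us vs where ns: "ns = us @ k # vs"
      by (auto simp: in_set_conv_decomp)
    have "sorted_wrt (<) ns"
      unfolding ns_def by (rule strict_sorted_list_of_set)
    then have "\<forall>l\<in>set us. l < k"
      unfolding ns by (simp add: sorted_wrt_append)
    then have "map (Poly_Mapping.lookup f) us = map (Poly_Mapping.lookup g) us"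
      using k(2) by simp
    then show ?thesis
      unfolding ns lex_conv using k(1) by fastforce
  qed
  then have "{(f, g :: 'n \<Rightarrow>\<^sub>0 nat). f < g} \<subseteq>
      inv_image (lex less_than) (\<lambda>f. map (Poly_Mapping.lookup f) ns)"
    by auto
  then show ?thesis
    by (rule wf_subset[rotated]) (intro wf_inv_image wf_lex wf_less_than)
qed

text \<open>Comparing leading exponents in \<open>q ^ m dvd c * r ^ m\<close> for large \<open>m\<close> gives that the leading
  monomial of \<open>q\<close> divides that of \<open>r\<close>, so one step of division can be performed; it
  preserves the hypothesis and lowers the leading exponent of \<open>r\<close>.\<close>

lemma mpoly_completely_integrally_closed:
  fixes q c r :: "('n::{finite,linorder}, 'a::field) mpoly"
  assumes "c \<noteq> 0" "q \<noteq> 0" "\<And>m. q ^ m dvd c * r ^ m"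
  shows "q dvd r"
  using assms(3)
proof (induction "Max (Poly_Mapping.keys r)" arbitrary: r rule: wf_induct_rule[OF wf_less_poly_mapping])
  case (1 r)
  show ?case
  proof (cases "r = 0")
    case False
    define a where "a = Max (Poly_Mapping.keys r)"
    define b where "b = Max (Poly_Mapping.keys q)"
    define e where "e = Max (Poly_Mapping.keys c)"
    have le: "Poly_Mapping.lookup b i \<le> Poly_Mapping.lookup a i" for i
    proof -
      have "m * Poly_Mapping.lookup b i \<le> Poly_Mapping.lookup e i + m * Poly_Mapping.lookup a i" for m
      proof -
        obtain s where s: "c * r ^ m = q ^ m * s"
          using "1.prems"[of m] by (auto elim: dvdE)
        have "s \<noteq> 0" using s \<open>c \<noteq> 0\<close> False by auto
        have "e + (\<Sum>_<m. a) = (\<Sum>_<m. b) + Max (Poly_Mapping.keys s)"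
          using arg_cong[OF s, of "\<lambda>f. Max (Poly_Mapping.keys f)"] \<open>s \<noteq> 0\<close> assms(1,2) False
          by (simp add: Max_keys_mult(2) Max_keys_power a_def b_def e_def)
        from arg_cong[OF this, of "\<lambda>f. Poly_Mapping.lookup f i"] show ?thesis
          by (simp add: lookup_add lookup_sum)
      qed
      \<comment> \<open>An excess of \<open>b\<close> over \<open>a\<close> at \<open>i\<close>
        would contribute at least \<open>m\<close> to the left side; the value of \<open>e\<close>
        at \<open>i\<close> cannot absorb it once \<open>m\<close> is larger than that
        value.\<close>
      from this[of "Suc (Poly_Mapping.lookup e i)"]
      have *: "Suc (Poly_Mapping.lookup e i) * Poly_Mapping.lookup b i
          \<le> Poly_Mapping.lookup e i + Suc (Poly_Mapping.lookup e i) * Poly_Mapping.lookup a i" .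
      show ?thesis
      proof (rule ccontr)
        assume "\<not> Poly_Mapping.lookup b i \<le> Poly_Mapping.lookup a i"
        then have "Suc (Poly_Mapping.lookup e i) * Suc (Poly_Mapping.lookup a i)
            \<le> Suc (Poly_Mapping.lookup e i) * Poly_Mapping.lookup b i"
          by (intro mult_le_mono) auto
        with * show False by simp
      qed
    qed
    \<comment> \<open>Subtraction of exponents is truncated at 0 in each variable; \<open>le\<close>
      makes it exact here.\<close>
    have ab: "(a - b) + b = a"
      by (intro poly_mapping_eqI) (simp add: lookup_add lookup_minus le)
    \<comment> \<open>The choice gives \<open>t * q\<close> the same leading term as
      \<open>r\<close>, in exponent and coefficient.\<close>
    define \<gamma> where "\<gamma> = Poly_Mapping.lookup r a / Poly_Mapping.lookup q b"
    define t where "t = Poly_Mapping.single (a - b) \<gamma>"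
    have ra: "Poly_Mapping.lookup r a \<noteq> 0" and qb: "Poly_Mapping.lookup q b \<noteq> 0"
      using Max_in[of "Poly_Mapping.keys r"] Max_in[of "Poly_Mapping.keys q"] False \<open>q \<noteq> 0\<close>
      by (auto simp: a_def b_def in_keys_iff)
    have "\<gamma> \<noteq> 0" using ra qb by (simp add: \<gamma>_def)
    then have t0: "t \<noteq> 0" and tk: "Max (Poly_Mapping.keys t) = a - b"
      unfolding t_def by (auto dest: arg_cong[where f = "\<lambda>f. Poly_Mapping.lookup f (a - b)"])
    have top: "Poly_Mapping.lookup (t * q) a = Poly_Mapping.lookup r a"
      using lookup_mult_Max[OF t0 \<open>q \<noteq> 0\<close>] qb
      unfolding tk b_def[symmetric] ab by (simp add: t_def \<gamma>_def)
    have tq: "Max (Poly_Mapping.keys (t * q)) = a"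
      using Max_keys_mult(2)[OF t0 \<open>q \<noteq> 0\<close>] unfolding tk b_def[symmetric] ab .
    define r' where "r' = r - t * q"
    have "q ^ m dvd c * r' ^ m" for m
    proof -
      \<comment> \<open>In the binomial expansion the hypothesis supplies \<open>q ^ k\<close> from
        \<open>c * r ^ k\<close>, and the power of \<open>t * q\<close> supplies the remaining
        \<open>q ^ (m - k)\<close>.\<close>
      have "c * r' ^ m = (\<Sum>k\<le>m. of_nat (m choose k) * (c * r ^ k) * (- t * q) ^ (m - k))"
        unfolding r'_def using binomial_ring[of r "- (t * q)" m]
        by (simp add: sum_distrib_left mult_ac)
      also have "q ^ m dvd \<dots>"
      proof (rule dvd_sum)
        fix k assume "k \<in> {..m}"
        then have "q ^ m = q ^ k * q ^ (m - k)"
          by (simp flip: power_add)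
        also have "\<dots> dvd (of_nat (m choose k) * (c * r ^ k)) * (- t * q) ^ (m - k)"
          by (rule mult_dvd_mono[OF dvd_mult[OF "1.prems"] dvd_power_same]) simp
        finally show "q ^ m dvd of_nat (m choose k) * (c * r ^ k) * (- t * q) ^ (m - k)" .
      qed
      finally show ?thesis .
    qed
    \<comment> \<open>The leading terms cancel, so the leading exponent drops. The case
      \<open>r' = 0\<close> is kept apart because the maximum would then be over the empty
      set.\<close>
    moreover have "Max (Poly_Mapping.keys r') < a" if "r' \<noteq> 0"
    proof -
      have in_r': "Max (Poly_Mapping.keys r') \<in> Poly_Mapping.keys r'"
        using that by (intro Max_in) auto
      have "Poly_Mapping.keys r' \<subseteq> Poly_Mapping.keys r \<union> Poly_Mapping.keys (t * q)"
        by (auto simp: r'_def in_keys_iff lookup_minus)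
      then have "Max (Poly_Mapping.keys r') \<in> Poly_Mapping.keys r \<union> Poly_Mapping.keys (t * q)"
        using in_r' by (rule subsetD)
      then have "Max (Poly_Mapping.keys r') \<le> a"
        using Max_ge[OF finite_keys, of _ r] Max_ge[OF finite_keys, of _ "t * q"]
        unfolding tq a_def[symmetric] by (elim UnE)
      moreover have "Poly_Mapping.lookup r' a = 0"
        by (simp add: r'_def lookup_minus top)
      ultimately show ?thesis
        using in_r' by (metis in_keys_iff order.not_eq_order_implies_strict)
    qed
    ultimately have "q dvd r'"
      using "1.hyps"[of r'] by (cases "r' = 0") (auto simp: a_def)
    then show ?thesis
      unfolding r'_def by (metis dvd_diff_left_iff dvd_triv_right)
  next
    case True
    then show ?thesis by simp
  qed
qed

text \<open>Here \<open>q ^ degree p\<close> is a common denominator of all powers of \<open>lead_coeff p * r / q\<close>.\<close>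

lemma lead_coeff_mult_root_integral:
  fixes p :: "('n::{finite,linorder}, 'a::field) mpoly poly"
  assumes "p \<noteq> 0" "q \<noteq> 0"
    and root: "(\<Sum>j\<le>degree p. coeff p j * r ^ j * q ^ (degree p - j)) = 0"
  shows "q dvd lead_coeff p * r"
proof -
  define d where "d = degree p"
  define L where "L = lead_coeff p"
  define u where "u = L * r"
  have "L \<noteq> 0" using \<open>p \<noteq> 0\<close> by (simp add: L_def)
  have "(\<Sum>j<d. coeff p j * r ^ j * q ^ (d - j)) + L * r ^ d = 0"
    using root by (simp add: d_def L_def lessThan_Suc_atMost[symmetric])
  then have top: "L * r ^ d = - (\<Sum>j<d. coeff p j * r ^ j * q ^ (d - j))"
    by (simp add: eq_neg_iff_add_eq_0 add.commute)
  \<comment> \<open>For \<open>d = 0\<close> the relation \<open>top\<close> would read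
    \<open>L = 0\<close>.\<close>
  have "d \<noteq> 0" using top \<open>L \<noteq> 0\<close> by (cases d) auto
  \<comment> \<open>Multiplying \<open>top\<close> by \<open>L ^ (d - 1)\<close> gives an equation
    monic in \<open>u\<close>; division by \<open>q ^ d\<close> turns it into an integral equation
    for \<open>u / q\<close>.\<close>
  have monic: "u ^ d = - (\<Sum>j<d. coeff p j * L ^ (d - 1 - j) * q ^ (d - j) * u ^ j)"
  proof -
    have "u ^ d = L ^ (d - 1) * (L * r ^ d)"
      using \<open>d \<noteq> 0\<close> by (cases d) (simp_all add: u_def power_mult_distrib mult_ac)
    also have "\<dots> = - (\<Sum>j<d. L ^ (d - 1) * (coeff p j * r ^ j * q ^ (d - j)))"
      unfolding top by (simp add: sum_distrib_left)
    also have "\<dots> = - (\<Sum>j<d. coeff p j * L ^ (d - 1 - j) * q ^ (d - j) * u ^ j)"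
    proof -
      have "L ^ (d - 1) = L ^ (d - 1 - j) * L ^ j" if "j < d" for j
        using that by (simp flip: power_add)
      then show ?thesis
        by (intro arg_cong[where f = uminus] sum.cong refl)
           (simp add: u_def power_mult_distrib mult_ac)
    qed
    finally show ?thesis .
  qed
  \<comment> \<open>Below \<open>d\<close> the factor \<open>q ^ d\<close> suffices. From
    \<open>d\<close> on, \<open>monic\<close> lowers the exponent of \<open>u\<close> by
    \<open>d - j\<close> and releases \<open>q ^ (d - j)\<close> in return.\<close>
  have "q ^ m dvd q ^ d * u ^ m" for m
  proof (induction m rule: less_induct)
    case (less m)
    show ?case
    proof (cases "m < d")
      case True
      then show ?thesis by (simp add: le_imp_power_dvd)
    next
      case False
      then have "q ^ d * u ^ m = q ^ d * (u ^ (m - d) * u ^ d)"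
        by (simp flip: power_add)
      also have "\<dots> = - (\<Sum>j<d. (coeff p j * L ^ (d - 1 - j)) * (q ^ (d - j) * (q ^ d * u ^ (m - d + j))))"
        unfolding monic by (simp add: sum_distrib_left power_add mult_ac)
      also have "q ^ m dvd \<dots>"
        unfolding dvd_minus_iff
      proof (rule dvd_sum)
        fix j assume "j \<in> {..<d}"
        with False have "q ^ m = q ^ (d - j) * q ^ (m - d + j)"
          by (simp flip: power_add)
        also have "\<dots> dvd q ^ (d - j) * (q ^ d * u ^ (m - d + j))"
          using less.IH[of "m - d + j"] False \<open>j \<in> {..<d}\<close> by (intro mult_dvd_mono) auto
        finally show "q ^ m dvd (coeff p j * L ^ (d - 1 - j)) * (q ^ (d - j) * (q ^ d * u ^ (m - d + j)))"
          by (rule dvd_mult)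
      qed
      finally show ?thesis .
    qed
  qed
  then show ?thesis
    unfolding u_def[symmetric] L_def[symmetric]
    using mpoly_completely_integrally_closed[of "q ^ d" q u] \<open>q \<noteq> 0\<close> by simp
qed

section \<open>Polynomials as formal sums and their action on formal sums\<close>

definition exponent :: "('n::finite \<Rightarrow>\<^sub>0 nat) \<Rightarrow> rat ^ 'n" where
  "exponent m = (\<chi> i. of_nat (Poly_Mapping.lookup m i))"

lemma exponent_0 [simp]: "exponent 0 = 0"
  by (simp add: exponent_def vec_eq_iff)

lemma exponent_add: "exponent (l + m) = exponent l + exponent m"
  by (simp add: exponent_def vec_eq_iff lookup_add)

lemma exponent_eq_iff [simp]: "exponent l = exponent m \<longleftrightarrow> l = m"
  by (auto simp: exponent_def vec_eq_iff intro: poly_mapping_eqI)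

lemma fs_of_mpoly_exponent [simp]: "fs_of_mpoly r (exponent m) = Poly_Mapping.lookup r m"
  unfolding fs_of_mpoly_def exponent_def[symmetric] by (auto simp: when_def in_keys_iff)

lemma fs_of_mpoly_outside: "K \<notin> range exponent \<Longrightarrow> fs_of_mpoly r K = 0"
  unfolding fs_of_mpoly_def exponent_def[symmetric] by (auto intro!: sum.neutral simp: when_def)

lemma fs_of_mpoly_eq_iff [simp]: "fs_of_mpoly r = fs_of_mpoly s \<longleftrightarrow> r = s"
  by (metis fs_of_mpoly_exponent poly_mapping_eqI)

lemma supp_fs_of_mpoly: "supp (fs_of_mpoly r) = exponent ` Poly_Mapping.keys r"
proof (intro set_eqI iffI)
  fix K assume "K \<in> supp (fs_of_mpoly r)"
  then show "K \<in> exponent ` Poly_Mapping.keys r"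
    by (cases "K \<in> range exponent") (auto simp: supp_def in_keys_iff fs_of_mpoly_outside)
qed (auto simp: supp_def in_keys_iff)

lemma fs_of_mpoly_0 [simp]: "fs_of_mpoly 0 = (\<lambda>_. 0)"
  by (simp add: fs_of_mpoly_def)

lemma fs_of_mpoly_add: "fs_of_mpoly (r + s) K = fs_of_mpoly r K + fs_of_mpoly s K"
  by (cases "K \<in> range exponent") (auto simp: lookup_add fs_of_mpoly_outside)

lemma fs_of_mpoly_sum: "fs_of_mpoly (sum f A) K = (\<Sum>j\<in>A. fs_of_mpoly (f j) K)"
  by (induction A rule: infinite_finite_induct) (simp_all add: fs_of_mpoly_add)

text \<open>The index set of \<open>fs_mult\<close> depends on the exact supports. Over a larger
  finite set the added terms have a zero factor, so products can be compared on a common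
  set.\<close>

lemma fs_mult_expand:
  assumes "finite A" "\<And>I. I \<in> supp \<phi> \<Longrightarrow> K - I \<in> supp \<psi> \<Longrightarrow> I \<in> A"
  shows "fs_mult \<phi> \<psi> K = (\<Sum>I\<in>A. \<phi> I * \<psi> (K - I))"
  unfolding fs_mult_def using assms by (intro sum.mono_neutral_left) (auto simp: supp_def)

text \<open>A polynomial factor leaves finitely many shifts of \<open>\<psi>\<close>, whatever the
  support of \<open>\<psi>\<close> is.\<close>

lemma fs_mult_of_mpoly:
  "fs_mult (fs_of_mpoly r) \<psi> K =
    (\<Sum>m\<in>Poly_Mapping.keys r. Poly_Mapping.lookup r m * \<psi> (K - exponent m))"
proof -
  have "fs_mult (fs_of_mpoly r) \<psi> K =
      (\<Sum>I\<in>exponent ` Poly_Mapping.keys r. fs_of_mpoly r I * \<psi> (K - I))"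
    by (rule fs_mult_expand) (auto simp: supp_fs_of_mpoly)
  then show ?thesis
    by (simp add: sum.reindex inj_on_def)
qed

lemma fs_mult_of_mpoly_superset:
  assumes "finite A" "Poly_Mapping.keys r \<subseteq> A"
  shows "fs_mult (fs_of_mpoly r) \<psi> K =
    (\<Sum>m\<in>A. Poly_Mapping.lookup r m * \<psi> (K - exponent m))"
  unfolding fs_mult_of_mpoly using assms
  by (intro sum.mono_neutral_left) (auto simp: in_keys_iff)

lemma fs_mult_of_mpoly_add:
  "fs_mult (fs_of_mpoly (r + s)) \<psi> K = fs_mult (fs_of_mpoly r) \<psi> K + fs_mult (fs_of_mpoly s) \<psi> K"
proof -
  let ?A = "Poly_Mapping.keys r \<union> Poly_Mapping.keys s"
  have "Poly_Mapping.keys (r + s) \<subseteq> ?A" by (rule keys_add)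
  then show ?thesis
    by (simp add: fs_mult_of_mpoly_superset[where A = ?A] lookup_add distrib_right sum.distrib)
qed

lemma fs_mult_of_mpoly_single:
  "fs_mult (fs_of_mpoly (Poly_Mapping.single m c)) \<psi> K = c * \<psi> (K - exponent m)"
  by (simp add: fs_mult_of_mpoly_superset[where A = "{m}"])

lemma fs_mult_of_mpoly_zero_left: "fs_mult (fs_of_mpoly 0) \<psi> K = 0"
  by (simp add: fs_mult_of_mpoly del: fs_of_mpoly_0)

lemma fs_mult_of_mpoly_sum_right:
  "fs_mult (fs_of_mpoly r) (\<lambda>K. \<Sum>j\<in>A. f j K) K = (\<Sum>j\<in>A. fs_mult (fs_of_mpoly r) (f j) K)"
  unfolding fs_mult_of_mpoly sum_distrib_left by (rule sum.swap)

lemma fs_mult_of_mpoly_diff_right: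
  fixes r :: "('n::finite, 'a::ring) mpoly"
  shows "fs_mult (fs_of_mpoly r) (\<lambda>K. \<phi> K - \<psi> K) K =
    fs_mult (fs_of_mpoly r) \<phi> K - fs_mult (fs_of_mpoly r) \<psi> K"
  by (simp add: fs_mult_of_mpoly right_diff_distrib sum_subtractf)

text \<open>Both sides are additive in \<open>r\<close> and in \<open>s\<close>. For monomials both
  shift by the sum of the exponents and scale by the product of the coefficients.\<close>

lemma fs_mult_of_mpoly_mult:
  fixes r s :: "('n::finite, 'a::comm_semiring_1) mpoly"
  shows "fs_mult (fs_of_mpoly (r * s)) \<psi> = fs_mult (fs_of_mpoly r) (fs_mult (fs_of_mpoly s) \<psi>)"
proof
  show "fs_mult (fs_of_mpoly (r * s)) \<psi> K = fs_mult (fs_of_mpoly r) (fs_mult (fs_of_mpoly s) \<psi>) K" for K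
  proof (induction r arbitrary: K rule: poly_mapping_additive_induct)
    case zero
    show ?case by (simp add: fs_mult_of_mpoly_zero_left del: fs_of_mpoly_0)
  next
    case (single l c)
    show ?case
    proof (induction s arbitrary: K rule: poly_mapping_additive_induct)
      case zero
      show ?case by (simp add: fs_mult_of_mpoly_single fs_mult_of_mpoly_zero_left del: fs_of_mpoly_0)
    next
      case (single m d)
      show ?case
        by (simp add: mult_single fs_mult_of_mpoly_single exponent_add mult.assoc diff_diff_eq)
    next
      case (add s t)
      then show ?case
        by (simp add: fs_mult_of_mpoly_single fs_mult_of_mpoly_add distrib_left)
    qed
  next
    case (add r t)
    then show ?case by (simp add: fs_mult_of_mpoly_add distrib_right)
  qed
qed

lemma fs_mult_1_right:
  fixes r :: "('n::finite, 'a::comm_semiring_1) mpoly"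
  shows "fs_mult (fs_of_mpoly r) (fs_of_mpoly 1) = fs_of_mpoly r"
proof
  show "fs_mult (fs_of_mpoly r) (fs_of_mpoly 1) K = fs_of_mpoly r K" for K
  proof -
    have "Poly_Mapping.lookup r m * fs_of_mpoly 1 (K - exponent m) =
        (Poly_Mapping.lookup r m when exponent m = K)" for m
    proof -
      have "fs_of_mpoly 1 (K - exponent m) = (if K = exponent m then 1 else (0::'a))"
      unfolding fs_of_mpoly_def exponent_def[symmetric] by (auto simp: when_def lookup_one)
      then show ?thesis by (auto simp: when_def)
    qed
    then show ?thesis
      unfolding fs_mult_of_mpoly by (simp add: fs_of_mpoly_def[of r] exponent_def)
  qed
qed

text \<open>The action law, applied to the formal sum 1, makes the embedding of polynomials
  multiplicative.\<close>

lemma fs_of_mpoly_mult: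
  fixes r s :: "('n::finite, 'a::comm_semiring_1) mpoly"
  shows "fs_of_mpoly (r * s) = fs_mult (fs_of_mpoly r) (fs_of_mpoly s)"
  using fs_mult_of_mpoly_mult[of r s "fs_of_mpoly 1"] by (simp add: fs_mult_1_right)

section \<open>Growth conditions on supports and finiteness of products\<close>

definition real_vec :: "rat ^ 'n::finite \<Rightarrow> real ^ 'n" where
  "real_vec I = (\<chi> i. of_rat (I $ i))"

lemma real_vec_add: "real_vec (I + J) = real_vec I + real_vec J"
  by (simp add: real_vec_def vec_eq_iff of_rat_add)

text \<open>The support condition of a series, weakened so that polynomials satisfy it as well: linear
  growth relative to the functional \<open>a\<close>, which bounds the norm on the cone.\<close>

definition tame ::
  "real ^ 'n \<Rightarrow> real \<Rightarrow> int \<Rightarrow> ('n::finite, 'a::zero) formal_sum \<Rightarrow> bool" where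
  "tame a B k \<phi> \<longleftrightarrow> (\<exists>D. \<forall>I\<in>supp \<phi>. norm (real_vec I) \<le> B * (a \<bullet> real_vec I) + D \<and>
     (\<forall>i. of_int k * I $ i \<in> \<int>))"

text \<open>Since \<open>C\<close> contains no line, 0 lies outside the convex hull of the non-zero
  generators. A hyperplane separates this compact set from 0, and its normal vector controls the
  norm on the generators, hence on the cone.\<close>

lemma pointed_cone_functional:
  fixes C :: "(real ^ 'n::finite) set"
  assumes "strictly_convex_rational_cone C"
  obtains a B where "B \<ge> 0" "\<forall>x\<in>C. norm x \<le> B * (a \<bullet> x)"
proof -
  obtain G where G: "finite G" "C = convex_cone hull G"
    and "\<not> (\<exists>a d. d \<noteq> 0 \<and> (\<forall>t::real. a + t *\<^sub>R d \<in> C))"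
    using assms unfolding strictly_convex_rational_cone_def by (elim conjE exE)
  then have noline: "\<exists>t::real. a + t *\<^sub>R d \<notin> C" if "d \<noteq> 0" for a d
    using that by blast
  have cone: "convex_cone C"
    unfolding G(2) by (rule convex_cone_convex_cone_hull)
  define G' where "G' = G - {0}"
  have G': "finite G'" "0 \<notin> G'" "\<And>g. g \<in> G' \<Longrightarrow> g \<in> C"
    using G by (auto simp: G'_def hull_inc)
  \<comment> \<open>A convex combination equal to 0 has a positive weight at some \<open>g\<close>;
    solving for \<open>- g\<close> puts the line through 0 and \<open>g\<close> into
    \<open>C\<close>.\<close>
  have "0 \<notin> convex hull G'"
  proof
    assume "0 \<in> convex hull G'"
    then obtain u where u: "\<And>x. x \<in> G' \<Longrightarrow> 0 \<le> u x" "sum u G' = 1" "(\<Sum>x\<in>G'. u x *\<^sub>R x) = 0"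
      by (auto simp: convex_hull_finite[OF \<open>finite G'\<close>])
    then obtain g where g: "g \<in> G'" "u g \<noteq> 0"
      by (metis sum.neutral zero_neq_one)
    have pos: "u g > 0" using u(1) g by force
    have sumC: "(\<Sum>x\<in>A. u x *\<^sub>R x) \<in> C" if "finite A" "A \<subseteq> G'" for A
      using that
    proof (induction A)
      case empty
      show ?case using convex_cone_contains_0[OF cone] by simp
    next
      case (insert x A)
      then show ?case
        using u(1) G'(3) by (simp add: convex_cone_add[OF cone] convex_cone_scaleR[OF cone])
    qed
    have "(\<Sum>x\<in>G' - {g}. u x *\<^sub>R x) = u g *\<^sub>R (- g)"
      using sum.remove[OF \<open>finite G'\<close> g(1), of "\<lambda>x. u x *\<^sub>R x"] u(3)
      by (simp add: eq_neg_iff_add_eq_0 add.commute)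
    then have "u g *\<^sub>R (- g) \<in> C"
      using sumC[of "G' - {g}"] \<open>finite G'\<close> by auto
    then have "inverse (u g) *\<^sub>R (u g *\<^sub>R (- g)) \<in> C"
      by (rule convex_cone_scaleR[OF cone, rotated]) (use pos in simp)
    moreover have "inverse (u g) *\<^sub>R (u g *\<^sub>R (- g)) = - g" using pos by simp
    ultimately have neg: "- g \<in> C" by (simp only:)
    have "0 + t *\<^sub>R g \<in> C" for t
    proof (cases "t \<ge> 0")
      case True
      then show ?thesis using convex_cone_scaleR[OF cone] G'(3) g(1) by simp
    next
      case False
      then show ?thesis using convex_cone_scaleR[OF cone, of "- t" "- g"] neg by simp
    qed
    then show False using noline[of g 0] g(1) G'(2) by auto
  qed
  moreover have "closed (convex hull G')"
    using \<open>finite G'\<close> by (simp add: compact_imp_closed finite_imp_compact_convex_hull)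
  ultimately obtain a b where b: "0 < b" "\<And>x. x \<in> convex hull G' \<Longrightarrow> a \<bullet> x > b"
    using separating_hyperplane_closed_0[of "convex hull G'"] by auto
  \<comment> \<open>\<open>M\<close> bounds the norm of each generator and \<open>b\<close> bounds
    \<open>a \<bullet> g\<close> from below, hence the factor \<open>M / b\<close>.\<close>
  define M where "M = (\<Sum>g\<in>G'. norm g)"
  have "M \<ge> 0" by (simp add: M_def sum_nonneg)
  define R where "R = M / b"
  have "R \<ge> 0" "M = R * b" using b(1) \<open>M \<ge> 0\<close> by (simp_all add: R_def)
  have M: "norm g \<le> R * (a \<bullet> g)" if "g \<in> G'" for g
  proof -
    have "norm g \<le> M" unfolding M_def by (rule member_le_sum) (use that \<open>finite G'\<close> in auto)
    also have "\<dots> \<le> R * (a \<bullet> g)"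
      unfolding \<open>M = R * b\<close> using b(2)[of g] \<open>R \<ge> 0\<close> that
      by (intro mult_left_mono) (auto simp: hull_inc less_imp_le)
    finally show ?thesis .
  qed
  \<comment> \<open>By the triangle inequality the desired estimate is stable under the cone
    operations, so it passes from the generators to \<open>C\<close>.\<close>
  let ?S = "{x. norm x \<le> R * (a \<bullet> x)}"
  have "convex_cone ?S"
    unfolding convex_cone_iff mem_Collect_eq
  proof (intro conjI ballI allI impI)
    show "norm 0 \<le> R * (a \<bullet> 0)" by simp
  next
    fix x y assume "x \<in> ?S" "y \<in> ?S"
    then show "norm (x + y) \<le> R * (a \<bullet> (x + y))"
      using norm_triangle_ineq[of x y] by (simp add: inner_add_right distrib_left)
  next
    fix x and c :: real assume "x \<in> ?S" "0 \<le> c"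
    then show "norm (c *\<^sub>R x) \<le> R * (a \<bullet> (c *\<^sub>R x))"
      using mult_left_mono[of "norm x" "R * (a \<bullet> x)" c] by (simp add: mult.left_commute)
  qed
  moreover have "g \<in> ?S" if "g \<in> G" for g
    using M[of g] that by (cases "g = 0") (simp_all add: G'_def)
  ultimately have "C \<subseteq> ?S"
    unfolding G(2) by (intro hull_minimal subsetI)
  then show thesis
    using \<open>R \<ge> 0\<close> by (intro that[of R a]) auto
qed

text \<open>The estimate on the cone survives the translation by \<open>v\<close> up to the constant
  \<open>norm v - B * (a \<bullet> v)\<close>.\<close>

lemma is_series_imp_tame:
  assumes "is_series \<phi>"
  obtains a B k where "B \<ge> 0" "k \<noteq> 0" "tame a B k \<phi>"
proof -
  obtain v C and k :: int where C: "strictly_convex_rational_cone C" and "k \<noteq> 0"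
    and s: "\<forall>I\<in>supp \<phi>. real_vec I \<in> (\<lambda>c. v + c) ` C \<and> (\<forall>i. of_int k * I $ i \<in> \<int>)"
    using assms unfolding is_series_def real_vec_def[symmetric] by (elim exE conjE) (rule that)
  obtain a B where B: "B \<ge> 0" "\<forall>x\<in>C. norm x \<le> B * (a \<bullet> x)"
    by (rule pointed_cone_functional[OF C])
  have "norm (real_vec I) \<le> B * (a \<bullet> real_vec I) + (norm v - B * (a \<bullet> v))" if I: "I \<in> supp \<phi>" for I
  proof -
    obtain c where c: "c \<in> C" "real_vec I = v + c" using s I by auto
    show ?thesis
      unfolding c(2) using bspec[OF B(2) c(1)] norm_triangle_ineq[of v c]
      by (simp add: inner_add_right distrib_left)
  qed
  then have "tame a B k \<phi>"
    unfolding tame_def using s by (intro exI[of _ "norm v - B * (a \<bullet> v)"]) simp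
  then show thesis using that B(1) \<open>k \<noteq> 0\<close> by blast
qed

text \<open>A finite set of integral exponents meets the condition for all parameters, so
  polynomials can be treated with those of any given series.\<close>

lemma tame_fs_of_mpoly: "tame a B k (fs_of_mpoly r)"
proof -
  define D where "D = Max ((\<lambda>I. norm (real_vec I) - B * (a \<bullet> real_vec I)) ` supp (fs_of_mpoly r))"
  have "norm (real_vec I) - B * (a \<bullet> real_vec I) \<le> D" if "I \<in> supp (fs_of_mpoly r)" for I
    unfolding D_def using that by (intro Max_ge) (auto simp: supp_fs_of_mpoly)
  then have "norm (real_vec I) \<le> B * (a \<bullet> real_vec I) + D" if "I \<in> supp (fs_of_mpoly r)" for I
    using that by (simp add: diff_le_eq add.commute)
  moreover have "of_int k * I $ i \<in> \<int>" if "I \<in> supp (fs_of_mpoly r)" for I i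
    using that by (auto simp: supp_fs_of_mpoly exponent_def)
  ultimately show ?thesis
    unfolding tame_def by blast
qed

lemma tame_union:
  assumes "tame a B k \<phi>" "tame a B k \<psi>" "supp \<eta> \<subseteq> supp \<phi> \<union> supp \<psi>"
  shows "tame a B k \<eta>"
proof -
  obtain D E where
    "\<And>I. I \<in> supp \<phi> \<Longrightarrow> norm (real_vec I) \<le> B * (a \<bullet> real_vec I) + D"
    "\<And>I. I \<in> supp \<psi> \<Longrightarrow> norm (real_vec I) \<le> B * (a \<bullet> real_vec I) + E"
    using assms(1,2) unfolding tame_def by blast
  then have "norm (real_vec I) \<le> B * (a \<bullet> real_vec I) + max D E" if "I \<in> supp \<eta>" for I
    using that assms(3) by (fastforce simp: max_def)
  moreover have "of_int k * I $ i \<in> \<int>" if "I \<in> supp \<eta>" for I i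
    using that assms unfolding tame_def by blast
  ultimately show ?thesis
    unfolding tame_def by blast
qed

lemma tame_sum:
  assumes "finite A" "\<And>j. j \<in> A \<Longrightarrow> tame a B k (f j)"
  shows "tame a B k (\<lambda>K. \<Sum>j\<in>A. f j K)"
  using assms
proof (induction A)
  case empty
  show ?case by (simp add: tame_def supp_def)
next
  case (insert j A)
  show ?case
    by (rule tame_union[of _ _ _ "f j" "\<lambda>K. \<Sum>j\<in>A. f j K"])
       (use insert in \<open>auto simp: supp_def\<close>)
qed

text \<open>A non-zero coefficient at \<open>K\<close> yields a decomposition of \<open>K\<close>
  into two support points, whether or not the index set is finite; the two estimates add up.\<close>

lemma tame_mult:
  assumes "tame a B k \<phi>" "tame a B k \<psi>"
  shows "tame a B k (fs_mult \<phi> \<psi>)"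
proof -
  obtain D E where
    D: "\<And>I. I \<in> supp \<phi> \<Longrightarrow> norm (real_vec I) \<le> B * (a \<bullet> real_vec I) + D" and
    E: "\<And>I. I \<in> supp \<psi> \<Longrightarrow> norm (real_vec I) \<le> B * (a \<bullet> real_vec I) + E"
    using assms unfolding tame_def by blast
  have "norm (real_vec K) \<le> B * (a \<bullet> real_vec K) + (D + E) \<and> (\<forall>i. of_int k * K $ i \<in> \<int>)"
    if "K \<in> supp (fs_mult \<phi> \<psi>)" for K
  proof -
    have "fs_mult \<phi> \<psi> K \<noteq> 0" using that by (simp add: supp_def)
    then have "{I. I \<in> supp \<phi> \<and> K - I \<in> supp \<psi>} \<noteq> {}"
      unfolding fs_mult_def by (rule contrapos_nn) (simp only: sum.empty)
    then obtain I where I: "I \<in> supp \<phi>" "K - I \<in> supp \<psi>" by blast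
    have K: "real_vec K = real_vec I + real_vec (K - I)"
      using real_vec_add[of I "K - I"] by simp
    have "norm (real_vec K) \<le> norm (real_vec I) + norm (real_vec (K - I))"
      unfolding K by (rule norm_triangle_ineq)
    also have "\<dots> \<le> B * (a \<bullet> real_vec K) + (D + E)"
      using D[OF I(1)] E[OF I(2)] unfolding K by (simp add: inner_add_right distrib_left)
    finally have *: "norm (real_vec K) \<le> B * (a \<bullet> real_vec K) + (D + E)" .
    have "of_int k * I $ i + of_int k * (K - I) $ i \<in> \<int>" for i
      using assms I unfolding tame_def by (intro Ints_add) blast+
    then show ?thesis using * by (simp flip: distrib_left)
  qed
  then show ?thesis unfolding tame_def by blast
qed

lemma tame_power: "tame a B k \<phi> \<Longrightarrow> tame a B k (fs_power \<phi> j)"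
  by (induction j) (simp_all add: tame_fs_of_mpoly tame_mult)

text \<open>Each coordinate is a fraction over \<open>k\<close> whose numerator is at most
  \<open>\<bar>k\<bar> * R\<close> in absolute value.\<close>

lemma finite_lattice_ball:
  assumes "k \<noteq> 0"
  shows "finite {I :: rat ^ 'n::finite. (\<forall>i. of_int k * I $ i \<in> \<int>) \<and> norm (real_vec I) \<le> R}"
proof -
  define N where "N = \<lceil>\<bar>of_int k\<bar> * R\<rceil>"
  have "I \<in> (\<lambda>f. \<chi> i. of_int (f i) / of_int k) ` (UNIV \<rightarrow>\<^sub>E {-N..N})"
    if I: "\<And>i. of_int k * I $ i \<in> \<int>" "norm (real_vec I) \<le> R" for I :: "rat ^ 'n"
  proof -
    have "\<forall>i. \<exists>n. of_int k * I $ i = of_int n"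
      using I(1) by (auto elim: Ints_cases)
    from choice[OF this] obtain f where f: "\<forall>i. of_int k * I $ i = of_int (f i)" ..
    have eq: "I = (\<chi> i. of_int (f i) / of_int k)"
      using assms by (simp add: vec_eq_iff f[rule_format, symmetric])
    have "\<bar>f i\<bar> \<le> N" for i
    proof -
      have "of_int (f i) = real_of_int k * of_rat (I $ i)"
        using arg_cong[OF f[rule_format, of i], of "of_rat :: rat \<Rightarrow> real"] by (simp add: of_rat_mult)
      then have "real_of_int \<bar>f i\<bar> = \<bar>of_int k\<bar> * \<bar>real_vec I $ i\<bar>"
        by (simp add: real_vec_def abs_mult)
      also have "\<dots> \<le> \<bar>of_int k\<bar> * R"
        using component_le_norm_cart[of "real_vec I" i] I(2) by (intro mult_left_mono) auto
      finally show ?thesis unfolding N_def by linarith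
    qed
    then have "f \<in> UNIV \<rightarrow>\<^sub>E {-N..N}" by (auto simp: abs_le_iff minus_le_iff)
    then show ?thesis using eq by blast
  qed
  then have "{I :: rat ^ 'n. (\<forall>i. of_int k * I $ i \<in> \<int>) \<and> norm (real_vec I) \<le> R} \<subseteq>
      (\<lambda>f. \<chi> i. of_int (f i) / of_int k) ` (UNIV \<rightarrow>\<^sub>E {-N..N})"
    by blast
  then show ?thesis
    by (rule finite_subset) (intro finite_imageI finite_PiE, auto)
qed

text \<open>For \<open>K = I + J\<close> the two estimates bound the sum of the norms of
  \<open>I\<close> and \<open>J\<close> by a constant once \<open>K\<close> is fixed, so
  \<open>I\<close> is a lattice point of a ball. Products of tame sums are thus genuine finite
  sums.\<close>

lemma tame_finite_fibre:
  fixes \<phi> \<psi> :: "('n::finite, 'a::zero) formal_sum"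
  assumes "k \<noteq> 0" "tame a B k \<phi>" "tame a B k \<psi>"
  shows "finite {I. I \<in> supp \<phi> \<and> K - I \<in> supp \<psi>}"
proof -
  obtain D E where
    D: "\<And>I. I \<in> supp \<phi> \<Longrightarrow> norm (real_vec I) \<le> B * (a \<bullet> real_vec I) + D" and
    E: "\<And>I. I \<in> supp \<psi> \<Longrightarrow> norm (real_vec I) \<le> B * (a \<bullet> real_vec I) + E"
    using assms(2,3) unfolding tame_def by blast
  have "norm (real_vec I) \<le> B * (a \<bullet> real_vec K) + (D + E)"
    if "I \<in> supp \<phi>" "K - I \<in> supp \<psi>" for I
  proof -
    have K: "real_vec K = real_vec I + real_vec (K - I)"
      using real_vec_add[of I "K - I"] by simp
    have "norm (real_vec I) \<le> norm (real_vec I) + norm (real_vec (K - I))"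
      by simp
    also have "\<dots> \<le> B * (a \<bullet> real_vec K) + (D + E)"
      using D[OF that(1)] E[OF that(2)] unfolding K by (simp add: inner_add_right distrib_left)
    finally show ?thesis .
  qed
  moreover have "of_int k * I $ i \<in> \<int>" if "I \<in> supp \<phi>" for I i
    using that assms(2) unfolding tame_def by blast
  ultimately show ?thesis
    by (intro finite_subset[OF _ finite_lattice_ball[OF \<open>k \<noteq> 0\<close>,
          of "B * (a \<bullet> real_vec K) + (D + E)"]]) auto
qed

text \<open>Additivity in \<open>r\<close> reduces the claim to a monomial, where it is a reindexing
  by the shift. Finite fibres provide the index sets on which the sums are compared.\<close>

lemma fs_mult_of_mpoly_assoc:
  fixes r :: "('n::finite, 'a::comm_semiring_1) mpoly"
  assumes k: "k \<noteq> 0" and \<phi>: "tame a B k \<phi>" and \<psi>: "tame a B k \<psi>"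
  shows "fs_mult (fs_of_mpoly r) (fs_mult \<phi> \<psi>) = fs_mult (fs_mult (fs_of_mpoly r) \<phi>) \<psi>"
proof
  show "fs_mult (fs_of_mpoly r) (fs_mult \<phi> \<psi>) K = fs_mult (fs_mult (fs_of_mpoly r) \<phi>) \<psi> K" for K
  proof (induction r rule: poly_mapping_additive_induct)
    case zero
    have "fs_mult (fs_of_mpoly 0) \<eta> = (\<lambda>_. 0)" for \<eta> :: "('n, 'a) formal_sum"
      by (simp add: fs_mult_of_mpoly_zero_left fun_eq_iff del: fs_of_mpoly_0)
    then show ?case by (simp add: fs_mult_def[of "\<lambda>_. 0"] supp_def)
  next
    case (single m c)
    let ?S = "{I \<in> supp \<phi>. (K - exponent m) - I \<in> supp \<psi>}"
    have fin: "finite ?S" using tame_finite_fibre[OF k \<phi> \<psi>] .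
    have "fs_mult (fs_mult (fs_of_mpoly (Poly_Mapping.single m c)) \<phi>) \<psi> K =
        (\<Sum>I\<in>(\<lambda>I. I + exponent m) ` ?S. c * \<phi> (I - exponent m) * \<psi> (K - I))"
      proof (subst fs_mult_expand)
      show "finite ((\<lambda>I. I + exponent m) ` ?S)" using fin by simp
      show "I \<in> (\<lambda>I. I + exponent m) ` ?S"
        if "I \<in> supp (fs_mult (fs_of_mpoly (Poly_Mapping.single m c)) \<phi>)" "K - I \<in> supp \<psi>" for I
        using that by (intro image_eqI[of _ _ "I - exponent m"])
          (auto simp: supp_def fs_mult_of_mpoly_single)
    qed (simp add: fs_mult_of_mpoly_single)
    also have "\<dots> = c * fs_mult \<phi> \<psi> (K - exponent m)"
      by (simp add: sum.reindex inj_on_def fs_mult_def sum_distrib_left mult.assoc algebra_simps)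
    finally show ?case unfolding fs_mult_of_mpoly_single by (rule sym)
  next
    case (add r s)
    let ?r = "fs_mult (fs_of_mpoly r) \<phi>" and ?s = "fs_mult (fs_of_mpoly s) \<phi>"
      and ?rs = "fs_mult (fs_of_mpoly (r + s)) \<phi>"
    \<comment> \<open>Terms may cancel in \<open>?rs\<close>, so its support is only contained in
      the union of the two supports; all sums are taken over the union of both fibres.\<close>
    let ?S = "{I \<in> supp ?r. K - I \<in> supp \<psi>} \<union> {I \<in> supp ?s. K - I \<in> supp \<psi>}"
    have fin: "finite ?S"
      using tame_finite_fibre[OF k tame_mult[OF tame_fs_of_mpoly \<phi>] \<psi>] by simp
    have "fs_mult ?rs \<psi> K = (\<Sum>I\<in>?S. ?rs I * \<psi> (K - I))"
      using fin by (rule fs_mult_expand) (auto simp: supp_def fs_mult_of_mpoly_add)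
    also have "\<dots> = (\<Sum>I\<in>?S. ?r I * \<psi> (K - I)) + (\<Sum>I\<in>?S. ?s I * \<psi> (K - I))"
      by (simp add: fs_mult_of_mpoly_add distrib_right sum.distrib)
    also have "(\<Sum>I\<in>?S. ?r I * \<psi> (K - I)) = fs_mult ?r \<psi> K"
      using fin by (rule fs_mult_expand[symmetric]) auto
    also have "(\<Sum>I\<in>?S. ?s I * \<psi> (K - I)) = fs_mult ?s \<psi> K"
      using fin by (rule fs_mult_expand[symmetric]) auto
    finally show ?case
      using add by (simp add: fs_mult_of_mpoly_add)
  qed
qed

section \<open>Torsion-freeness of series over the polynomials\<close>

text \<open>The lexicographic order on \<^typ>\<open>rat ^ 'n\<close>, taken from the order on finitely supported
  functions.\<close>

definition lex_key :: "rat ^ 'n::finite \<Rightarrow> 'n \<Rightarrow>\<^sub>0 rat" where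
  "lex_key I = Abs_poly_mapping (vec_nth I)"

lemma lookup_lex_key [simp]: "Poly_Mapping.lookup (lex_key I) i = I $ i"
  by (simp add: lex_key_def)

lemma lex_key_eq_iff [simp]: "lex_key I = lex_key J \<longleftrightarrow> I = J"
  by (metis lookup_lex_key vec_eq_iff)

lemma lex_key_add: "lex_key (I + J) = lex_key I + lex_key J"
  by (intro poly_mapping_eqI) (simp add: lookup_add)

text \<open>Below the level of one support point the norm is bounded, so only finitely many
  exponents compete and \<open>a\<close> attains its minimum. As \<open>a\<close> need not separate
  exponents, ties are broken lexicographically.\<close>

lemma tame_minimal_exponent:
  fixes \<phi> :: "('n::{finite,linorder}, 'a::zero) formal_sum"
  assumes "B \<ge> 0" "k \<noteq> 0" "tame a B k \<phi>" "supp \<phi> \<noteq> {}"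
  obtains I where "I \<in> supp \<phi>" "\<And>J. J \<in> supp \<phi> \<Longrightarrow> a \<bullet> real_vec I \<le> a \<bullet> real_vec J"
    "\<And>J. J \<in> supp \<phi> \<Longrightarrow> a \<bullet> real_vec J = a \<bullet> real_vec I \<Longrightarrow> lex_key I \<le> lex_key J"
proof -
  obtain D where D: "\<And>I. I \<in> supp \<phi> \<Longrightarrow> norm (real_vec I) \<le> B * (a \<bullet> real_vec I) + D"
    "\<And>I i. I \<in> supp \<phi> \<Longrightarrow> of_int k * I $ i \<in> \<int>"
    using assms(3) unfolding tame_def by blast
  obtain I0 where I0: "I0 \<in> supp \<phi>" using assms(4) by blast
  define S where "S = {I \<in> supp \<phi>. a \<bullet> real_vec I \<le> a \<bullet> real_vec I0}"
  have "norm (real_vec I) \<le> B * (a \<bullet> real_vec I0) + D" if "I \<in> S" for I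
    using that D(1)[of I] mult_left_mono[OF _ \<open>B \<ge> 0\<close>, of "a \<bullet> real_vec I" "a \<bullet> real_vec I0"]
    by (auto simp: S_def)
  then have "finite S"
    using D(2) by (intro finite_subset[OF _ finite_lattice_ball[OF \<open>k \<noteq> 0\<close>,
          of "B * (a \<bullet> real_vec I0) + D"]]) (auto simp: S_def)
  define c where "c = Min ((\<lambda>I. a \<bullet> real_vec I) ` S)"
  have "I0 \<in> S" using I0 by (simp add: S_def)
  have "c \<in> (\<lambda>I. a \<bullet> real_vec I) ` S"
    unfolding c_def using \<open>finite S\<close> \<open>I0 \<in> S\<close> by (intro Min_in) auto
  have c_le: "c \<le> a \<bullet> real_vec J" if "J \<in> supp \<phi>" for J
  proof (cases "J \<in> S")
    case True
    then show ?thesis unfolding c_def using \<open>finite S\<close> by simp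
  next
    case False
    have "c \<le> a \<bullet> real_vec I0" unfolding c_def using \<open>finite S\<close> \<open>I0 \<in> S\<close> by simp
    then show ?thesis using False that by (auto simp: S_def)
  qed
  define T where "T = {I \<in> S. a \<bullet> real_vec I = c}"
  have "finite T" "T \<noteq> {}"
    using \<open>finite S\<close> \<open>c \<in> _\<close> by (auto simp: T_def)
  then have "Min (lex_key ` T) \<in> lex_key ` T" by (intro Min_in) auto
  then obtain I where I: "I \<in> T" "lex_key I = Min (lex_key ` T)" by auto
  show thesis
  proof (rule that[of I])
    show "I \<in> supp \<phi>" using I(1) by (simp add: T_def S_def)
    have Ic: "a \<bullet> real_vec I = c" using I(1) by (simp add: T_def)
    show "a \<bullet> real_vec I \<le> a \<bullet> real_vec J" if "J \<in> supp \<phi>" for J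
      using c_le[OF that] Ic by simp
    show "lex_key I \<le> lex_key J" if "J \<in> supp \<phi>" "a \<bullet> real_vec J = a \<bullet> real_vec I" for J
    proof -
      have "J \<in> T" using that Ic c_le[OF I0] by (simp add: T_def S_def)
      then show ?thesis unfolding I(2) using \<open>finite T\<close> by simp
    qed
  qed
qed

text \<open>Let \<open>I\<close> and \<open>J\<close> be minimal exponents of \<open>q\<close> and
  \<open>\<phi>\<close> in the same translation-invariant order. Then \<open>I + J\<close> has no
  other decomposition, so its coefficient is a product of two non-zero elements of a domain.\<close>

lemma fs_mult_of_mpoly_eq_0:
  fixes q :: "('n::{finite,linorder}, 'a::idom) mpoly"
  assumes "B \<ge> 0" "k \<noteq> 0" "tame a B k \<phi>" "q \<noteq> 0"
    and zero: "fs_mult (fs_of_mpoly q) \<phi> = (\<lambda>_. 0)"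
  shows "\<phi> = (\<lambda>_. 0)"
proof (rule ccontr)
  assume "\<phi> \<noteq> (\<lambda>_. 0)"
  then have "supp \<phi> \<noteq> {}" by (auto simp: supp_def)
  then obtain J where J: "J \<in> supp \<phi>" "\<And>J'. J' \<in> supp \<phi> \<Longrightarrow> a \<bullet> real_vec J \<le> a \<bullet> real_vec J'"
    "\<And>J'. J' \<in> supp \<phi> \<Longrightarrow> a \<bullet> real_vec J' = a \<bullet> real_vec J \<Longrightarrow> lex_key J \<le> lex_key J'"
    using tame_minimal_exponent[OF assms(1-3)] by blast
  have "supp (fs_of_mpoly q) \<noteq> {}" using \<open>q \<noteq> 0\<close> by (simp add: supp_fs_of_mpoly)
  then obtain I where I: "I \<in> supp (fs_of_mpoly q)"
    "\<And>I'. I' \<in> supp (fs_of_mpoly q) \<Longrightarrow> a \<bullet> real_vec I \<le> a \<bullet> real_vec I'"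
    "\<And>I'. I' \<in> supp (fs_of_mpoly q) \<Longrightarrow> a \<bullet> real_vec I' = a \<bullet> real_vec I \<Longrightarrow> lex_key I \<le> lex_key I'"
    using tame_minimal_exponent[OF assms(1,2) tame_fs_of_mpoly] by blast
  have "I' = I" if I': "I' \<in> supp (fs_of_mpoly q)" "(I + J) - I' \<in> supp \<phi>" for I'
  proof -
    define J' where "J' = (I + J) - I'"
    have sum: "I' + J' = I + J" by (simp add: J'_def)
    have "J' \<in> supp \<phi>" using I'(2) by (simp add: J'_def)
    have "a \<bullet> real_vec I' + a \<bullet> real_vec J' = a \<bullet> real_vec I + a \<bullet> real_vec J"
      using arg_cong[OF sum, of "\<lambda>K. a \<bullet> real_vec K"] by (simp add: real_vec_add inner_add_right)
    \<comment> \<open>Neither summand can fall below its minimum, so equal sums force equality in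
      both; the lexicographic keys are then compared in the same way.\<close>
    then have "a \<bullet> real_vec I' = a \<bullet> real_vec I" "a \<bullet> real_vec J' = a \<bullet> real_vec J"
      using I(2)[OF I'(1)] J(2)[OF \<open>J' \<in> supp \<phi>\<close>] by auto
    then have "lex_key I \<le> lex_key I'" "lex_key J \<le> lex_key J'"
      using I(3) J(3) I'(1) \<open>J' \<in> supp \<phi>\<close> by auto
    moreover have "lex_key I' + lex_key J' = lex_key I + lex_key J"
      using sum by (metis lex_key_add)
    ultimately have "lex_key I' = lex_key I"
      by (metis add_less_le_mono order.not_eq_order_implies_strict order.irrefl)
    then show ?thesis by simp
  qed
  then have "fs_mult (fs_of_mpoly q) \<phi> (I + J) = fs_of_mpoly q I * \<phi> J"
    by (subst fs_mult_expand[of "{I}"]) auto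
  moreover have "fs_of_mpoly q I * \<phi> J \<noteq> 0"
    using I(1) J(1) by (simp add: supp_def)
  ultimately show False using zero by (simp add: fun_eq_iff)
qed

lemma fs_mult_of_mpoly_cancel:
  fixes q :: "('n::{finite,linorder}, 'a::idom) mpoly"
  assumes "B \<ge> 0" "k \<noteq> 0" "tame a B k \<phi>" "tame a B k \<psi>" "q \<noteq> 0"
    and eq: "fs_mult (fs_of_mpoly q) \<phi> = fs_mult (fs_of_mpoly q) \<psi>"
  shows "\<phi> = \<psi>"
proof -
  have "tame a B k (\<lambda>K. \<phi> K - \<psi> K)"
    by (rule tame_union[OF assms(3,4)]) (auto simp: supp_def)
  moreover have "fs_mult (fs_of_mpoly q) (\<lambda>K. \<phi> K - \<psi> K) = (\<lambda>_. 0)"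
    by (rule ext) (simp add: fs_mult_of_mpoly_diff_right eq)
  ultimately have "(\<lambda>K. \<phi> K - \<psi> K) = (\<lambda>_. 0)"
    using fs_mult_of_mpoly_eq_0[OF assms(1,2) _ \<open>q \<noteq> 0\<close>] by blast
  then show ?thesis by (simp add: fun_eq_iff)
qed

section \<open>Clearing denominators in the equation\<close>

text \<open>One factor \<open>q\<close> at a time is moved next to one factor \<open>\<phi>\<close>
  and turns it into \<open>r\<close>.\<close>

lemma fs_mult_power:
  fixes q r :: "('n::finite, 'a::comm_semiring_1) mpoly"
  assumes "k \<noteq> 0" "tame a B k \<phi>" and qr: "fs_mult (fs_of_mpoly q) \<phi> = fs_of_mpoly r"
  shows "fs_mult (fs_of_mpoly (q ^ j)) (fs_power \<phi> j) = fs_of_mpoly (r ^ j)"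
proof (induction j)
  case 0
  show ?case by (simp add: fs_mult_1_right)
next
  case (Suc j)
  have "fs_mult (fs_of_mpoly (q ^ Suc j)) (fs_power \<phi> (Suc j)) =
      fs_mult (fs_of_mpoly (q ^ j * q)) (fs_mult \<phi> (fs_power \<phi> j))"
    by (simp add: mult.commute)
  also have "\<dots> = fs_mult (fs_of_mpoly (q ^ j)) (fs_mult (fs_of_mpoly r) (fs_power \<phi> j))"
    unfolding fs_mult_of_mpoly_mult
    by (simp add: fs_mult_of_mpoly_assoc[OF assms(1,2) tame_power[OF assms(2)]] qr)
  also have "\<dots> = fs_mult (fs_of_mpoly r) (fs_mult (fs_of_mpoly (q ^ j)) (fs_power \<phi> j))"
    by (simp only: fs_mult_of_mpoly_mult[symmetric] mult.commute)
  also have "\<dots> = fs_of_mpoly (r ^ Suc j)"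
    unfolding Suc.IH by (simp add: fs_of_mpoly_mult)
  finally show ?case .
qed

lemma fs_mult_fs_eval:
  fixes q r :: "('n::finite, 'a::comm_semiring_1) mpoly"
  assumes "k \<noteq> 0" "tame a B k \<phi>" and qr: "fs_mult (fs_of_mpoly q) \<phi> = fs_of_mpoly r"
  shows "fs_mult (fs_of_mpoly (q ^ degree p)) (fs_eval p \<phi>) =
    fs_of_mpoly (\<Sum>j\<le>degree p. coeff p j * r ^ j * q ^ (degree p - j))"
proof
  fix K
  have "fs_mult (fs_of_mpoly (q ^ degree p)) (fs_mult (fs_of_mpoly (coeff p j)) (fs_power \<phi> j)) =
      fs_of_mpoly (coeff p j * r ^ j * q ^ (degree p - j))" if "j \<le> degree p" for j
  proof -
    \<comment> \<open>The part \<open>q ^ j\<close> clears \<open>fs_power \<phi> j\<close>; the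
      rest stays with the coefficient.\<close>
    have "q ^ degree p * coeff p j = (coeff p j * q ^ (degree p - j)) * q ^ j"
      using that by (simp add: mult_ac flip: power_add)
    then have "fs_mult (fs_of_mpoly (q ^ degree p)) (fs_mult (fs_of_mpoly (coeff p j)) (fs_power \<phi> j)) =
        fs_mult (fs_of_mpoly (coeff p j * q ^ (degree p - j))) (fs_of_mpoly (r ^ j))"
      by (metis fs_mult_of_mpoly_mult fs_mult_power[OF assms])
    then show ?thesis by (simp add: mult_ac flip: fs_of_mpoly_mult)
  qed
  then show "fs_mult (fs_of_mpoly (q ^ degree p)) (fs_eval p \<phi>) K =
      fs_of_mpoly (\<Sum>j\<le>degree p. coeff p j * r ^ j * q ^ (degree p - j)) K"
    by (simp add: fs_eval_def fs_mult_of_mpoly_sum_right fs_of_mpoly_sum)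
qed

lemma tame_fs_eval: "tame a B k \<phi> \<Longrightarrow> tame a B k (fs_eval p \<phi>)"
  unfolding fs_eval_def by (intro tame_sum tame_mult tame_fs_of_mpoly tame_power) simp

text \<open>Multiplying by a power of the leading coefficient, which is non-zero in the fraction
  field, clears all denominators. The sum is that of \<open>fs_mult_fs_eval\<close> with
  \<open>lead_coeff p\<close> for \<open>q\<close> and \<open>s\<close> for \<open>r\<close>, which
  links the two kinds of solutions.\<close>

lemma poly_subst_y_div_lc_eq_0_iff:
  fixes p :: "('n::{finite,linorder}, 'a::field) mpoly poly"
  assumes "p \<noteq> 0"
  shows "poly (subst_y_div_lc p) (to_fract s) = 0 \<longleftrightarrow>
    (\<Sum>j\<le>degree p. coeff p j * s ^ j * lead_coeff p ^ (degree p - j)) = 0"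
proof -
  define L where "L = lead_coeff p"
  have L: "to_fract L \<noteq> 0" using assms by (simp add: L_def)
  have pow: "to_fract (x ^ n) = to_fract x ^ n" for x :: "('n, 'a) mpoly" and n
    by (induction n) simp_all
  have "poly (subst_y_div_lc p) (to_fract s) = poly (fract_poly p) (to_fract s / to_fract L)"
    by (simp add: subst_y_div_lc_def poly_pcompose L_def)
  then have "to_fract L ^ degree p * poly (subst_y_div_lc p) (to_fract s) =
      (\<Sum>j\<le>degree p. to_fract L ^ degree p * (to_fract (coeff p j) * (to_fract s / to_fract L) ^ j))"
    by (simp add: poly_altdef sum_distrib_left degree_map_poly coeff_map_poly)
  also have "\<dots> = (\<Sum>j\<le>degree p. to_fract (coeff p j * s ^ j * L ^ (degree p - j)))"
  proof (intro sum.cong refl)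
    fix j assume "j \<in> {..degree p}"
    then have "to_fract L ^ degree p = to_fract L ^ (degree p - j) * to_fract L ^ j"
      by (simp flip: power_add)
    then show "to_fract L ^ degree p * (to_fract (coeff p j) * (to_fract s / to_fract L) ^ j) =
        to_fract (coeff p j * s ^ j * L ^ (degree p - j))"
      using L by (simp add: pow power_divide mult_ac)
  qed
  also have "\<dots> = to_fract (\<Sum>j\<le>degree p. coeff p j * s ^ j * L ^ (degree p - j))"
    by simp
  finally have eq: "to_fract L ^ degree p * poly (subst_y_div_lc p) (to_fract s) =
      to_fract (\<Sum>j\<le>degree p. coeff p j * s ^ j * L ^ (degree p - j))" .
  have "poly (subst_y_div_lc p) (to_fract s) = 0 \<longleftrightarrow>
      to_fract L ^ degree p * poly (subst_y_div_lc p) (to_fract s) = 0"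
    using L by simp
  then show ?thesis
    by (simp only: eq to_fract_eq_0_iff flip: L_def)
qed

theorem corollary2:
  fixes p :: "('n::{finite,linorder}, 'a::{alg_closed_field,field_char_0}) mpoly poly"
    and \<phi> :: "('n, 'a) formal_sum"
  assumes "p \<noteq> 0"
    and "is_series \<phi>"
  shows "rational_solution p \<phi> \<longleftrightarrow>
         polynomial_solution (subst_y_div_lc p) (fs_mult (fs_of_mpoly (lead_coeff p)) \<phi>)"
proof -
  \<comment> \<open>One choice of parameters serves \<open>\<phi>\<close>, its powers and all
    polynomials; cancellation requires common ones.\<close>
  obtain a B k where B: "B \<ge> 0" and k: "k \<noteq> 0" and tame: "tame a B k \<phi>"
    using is_series_imp_tame[OF assms(2)] .
  define L where "L = lead_coeff p"
  define d where "d = degree p"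
  have "L \<noteq> 0" using assms(1) by (simp add: L_def)
  have "polynomial_solution (subst_y_div_lc p) (fs_mult (fs_of_mpoly L) \<phi>)"
    if "rational_solution p \<phi>"
  proof -
    obtain r q where q: "q \<noteq> 0" and qr: "fs_mult (fs_of_mpoly q) \<phi> = fs_of_mpoly r"
      and "fs_eval p \<phi> = (\<lambda>_. 0)"
      using \<open>rational_solution p \<phi>\<close> unfolding rational_solution_def is_rational_def by blast
    then have "fs_of_mpoly (\<Sum>j\<le>d. coeff p j * r ^ j * q ^ (d - j)) = fs_of_mpoly 0"
      using fs_mult_fs_eval[OF k tame qr, of p] by (simp add: fs_mult_of_mpoly d_def fun_eq_iff)
    then have root: "(\<Sum>j\<le>d. coeff p j * r ^ j * q ^ (d - j)) = 0"
      unfolding fs_of_mpoly_eq_iff .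
    then obtain s where s: "L * r = q * s"
      using lead_coeff_mult_root_integral[OF assms(1) q, of r] by (auto simp: L_def d_def)
    \<comment> \<open>Both sides are the formal sum of \<open>L * r\<close>; torsion-freeness then
      cancels \<open>q\<close>.\<close>
    have "fs_mult (fs_of_mpoly q) (fs_mult (fs_of_mpoly L) \<phi>) = fs_mult (fs_of_mpoly q) (fs_of_mpoly s)"
      by (metis fs_mult_of_mpoly_mult fs_of_mpoly_mult mult.commute qr s)
    then have "fs_mult (fs_of_mpoly L) \<phi> = fs_of_mpoly s"
      by (rule fs_mult_of_mpoly_cancel[OF B k tame_mult[OF tame_fs_of_mpoly tame] tame_fs_of_mpoly q])
    moreover have "(\<Sum>j\<le>d. coeff p j * s ^ j * L ^ (d - j)) = 0"
    proof -
      \<comment> \<open>The fractions \<open>r / q\<close> and \<open>s / L\<close> agree, so the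
        cleared equations for them differ only by the factors \<open>q ^ d\<close> and
        \<open>L ^ d\<close>.\<close>
      have step: "q ^ d * (coeff p j * s ^ j * L ^ (d - j)) = L ^ d * (coeff p j * r ^ j * q ^ (d - j))"
        if "j \<le> d" for j
      proof -
        have "q ^ d = q ^ (d - j) * q ^ j"
          using that by (simp flip: power_add)
        then have "q ^ d * s ^ j = q ^ (d - j) * (L * r) ^ j"
          unfolding s power_mult_distrib by (simp only: mult.assoc)
        moreover have "L ^ d = L ^ (d - j) * L ^ j"
          using that by (simp flip: power_add)
        ultimately show ?thesis
          by (simp add: power_mult_distrib)
      qed
      have "q ^ d * (\<Sum>j\<le>d. coeff p j * s ^ j * L ^ (d - j)) =
          L ^ d * (\<Sum>j\<le>d. coeff p j * r ^ j * q ^ (d - j))"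
        unfolding sum_distrib_left by (intro sum.cong refl step) simp
      then show ?thesis using root q by simp
    qed
    ultimately show ?thesis
      unfolding polynomial_solution_def
      using poly_subst_y_div_lc_eq_0_iff[OF assms(1)] by (auto simp: L_def d_def)
  qed
  moreover have "rational_solution p \<phi>"
    if sol: "polynomial_solution (subst_y_div_lc p) (fs_mult (fs_of_mpoly L) \<phi>)"
  proof -
    \<comment> \<open>Here \<open>L\<close> itself is the denominator: \<open>s\<close> and
      \<open>L\<close> witness that \<open>\<phi>\<close> is rational, and only the equation is left
      to prove.\<close>
    obtain s where s: "fs_mult (fs_of_mpoly L) \<phi> = fs_of_mpoly s"
      and "poly (subst_y_div_lc p) (to_fract s) = 0"
      using sol unfolding polynomial_solution_def by blast
    then have "(\<Sum>j\<le>d. coeff p j * s ^ j * L ^ (d - j)) = 0"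
      using poly_subst_y_div_lc_eq_0_iff[OF assms(1)] by (simp add: L_def d_def)
    then have "fs_mult (fs_of_mpoly (L ^ d)) (fs_eval p \<phi>) = (\<lambda>_. 0)"
      using fs_mult_fs_eval[OF k tame s, of p] by (simp add: d_def)
    then have "fs_eval p \<phi> = (\<lambda>_. 0)"
      by (rule fs_mult_of_mpoly_eq_0[OF B k tame_fs_eval[OF tame], rotated])
        (use \<open>L \<noteq> 0\<close> in simp)
    then show ?thesis
      using s \<open>L \<noteq> 0\<close> unfolding rational_solution_def is_rational_def by blast
  qed
  ultimately show ?thesis unfolding L_def by blast
qed

end
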